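(* Let $G$ be a finite group satisfying $\mathrm{cyc}(G)<2^{\pi(G)+2}$. Then $$G\cong A\times S\times C,$$ where $A$ is cyclic of squarefree order, $C$ is cyclic, $\gcd(|A|,|S||C|)=1$, $\gcd(|S|,|C|)=1$, either $S=1$ or $S$ is a fundamental block for the cyclic-subgroup threshold, and $$\eta(S)\,\delta(C)<4.$$ Moreover, writing $C\cong C_{\ell_1^{a_1}}\times\cdots\times C_{\ell_r^{a_r}}$ with distinct primes $\ell_i$ and nontrivial factors, every exponent satisfies $a_i\ge2$. Conversely, every product $A\times S\times C$ with all these properties satisfies $\mathrm{cyc}(G)<2^{\pi(G)+2}$. When $S=1$, the possible exponent patterns for $C$, ordered as $a_1\ge\cdots\ge a_r\ge2$, are exactly: - $r=0$: empty; - $r=1$: $2\le a_1\le6$; - $r=2$: $(a,2)$ with $2\le a\le4$; - $r=3$: $(2,2,2)$.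
   Context: For a finite group $G$, $\mathrm{cyc}(G)$ is the number of cyclic subgroups of $G$ (including the trivial one), $\pi(G)$ is the number of distinct prime divisors of $|G|$ ($\pi(1)=0$), and $\eta(G)=\mathrm{cyc}(G)/2^{\pi(G)}$, so $\eta(1)=1$. For a cyclic group $C$, $\delta(C)=d(|C|)/2^{\pi(C)}$, where $d(k)$ is the number of positive divisors of $k$. $C_k$ is the cyclic group of order $k$. A finite group is squarefree-reduced if it has no central Sylow subgroup of prime order. A fundamental block for the cyclic-subgroup threshold is a nontrivial squarefree-reduced finite group $S$ that has no central cyclic Sylow subgroup (for any prime dividing $|S|$) and satisfies $\eta(S)<4$. *)

theory Defs
  imports
    Complex_Main
    "HOL-Algebra.Product_Groups"
    "HOL-Computational_Algebra.Squarefree"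
begin

definition cyc :: "'a monoid \<Rightarrow> nat" where
  "cyc G = card {H. subgroup H G \<and> cyclic_group (G\<lparr>carrier := H\<rparr>)}"

definition num_primes :: "'a monoid \<Rightarrow> nat" where
  "num_primes G = card (prime_factors (order G))"

definition eta :: "'a monoid \<Rightarrow> real" where
  "eta G = real (cyc G) / 2 ^ num_primes G"

definition delta :: "'a monoid \<Rightarrow> real" where
  "delta C = real (card {d. d dvd order C}) / 2 ^ num_primes C"

definition group_center :: "'a monoid \<Rightarrow> 'a set" where
  "group_center G = {z \<in> carrier G. \<forall>x \<in> carrier G. z \<otimes>\<^bsub>G\<^esub> x = x \<otimes>\<^bsub>G\<^esub> z}"

(* Only primes dividing the order are considered, so the trivial subgroup is never a Sylow
   subgroup in this sense. *)
definition sylow_subgroup :: "nat \<Rightarrow> 'a set \<Rightarrow> 'a monoid \<Rightarrow> bool" where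
  "sylow_subgroup p P G \<longleftrightarrow>
     prime p \<and> p dvd order G \<and> subgroup P G \<and> card P = p ^ multiplicity p (order G)"

definition squarefree_reduced :: "'a monoid \<Rightarrow> bool" where
  "squarefree_reduced G \<longleftrightarrow>
     \<not> (\<exists>p P. sylow_subgroup p P G \<and> prime (card P) \<and> P \<subseteq> group_center G)"

definition fundamental_block :: "'a monoid \<Rightarrow> bool" where
  "fundamental_block S \<longleftrightarrow>
     group S \<and> finite (carrier S) \<and> \<not> trivial_group S \<and> squarefree_reduced S \<and>
     \<not> (\<exists>p P. sylow_subgroup p P S \<and> cyclic_group (S\<lparr>carrier := P\<rparr>) \<and> P \<subseteq> group_center S) \<and>
     eta S < 4"

(* C is isomorphic to the product of the cyclic groups of order (ls ! i) ^ (as ! i), for distinct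
   primes ls ! i and positive exponents as ! i; the empty product is the trivial group. *)
definition primary_decomposition :: "'a monoid \<Rightarrow> nat list \<Rightarrow> nat list \<Rightarrow> bool" where
  "primary_decomposition C ls as \<longleftrightarrow>
     length ls = length as \<and> distinct ls \<and> (\<forall>l \<in> set ls. prime l) \<and> (\<forall>a \<in> set as. 1 \<le> a) \<and>
     C \<cong> product_group {..<length as} (\<lambda>i. integer_mod_group (ls ! i ^ as ! i))"

(* The existence of a primary decomposition is automatic for a finite cyclic C; stating it
   keeps the requirement on the exponents from being vacuous. *)
definition threshold_triple :: "'a monoid \<Rightarrow> 'b monoid \<Rightarrow> 'c monoid \<Rightarrow> bool" where
  "threshold_triple A S C \<longleftrightarrow>
     group A \<and> finite (carrier A) \<and> cyclic_group A \<and> squarefree (order A) \<and>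
     group S \<and> finite (carrier S) \<and> (trivial_group S \<or> fundamental_block S) \<and>
     group C \<and> finite (carrier C) \<and> cyclic_group C \<and>
     coprime (order A) (order S * order C) \<and> coprime (order S) (order C) \<and>
     eta S * delta C < 4 \<and>
     (\<exists>ls as. primary_decomposition C ls as) \<and>
     (\<forall>ls as. primary_decomposition C ls as \<longrightarrow> (\<forall>a \<in> set as. 2 \<le> a))"

definition threshold_patterns :: "nat list set" where
  "threshold_patterns =
     {[]} \<union> {[a] | a. 2 \<le> a \<and> a \<le> 6} \<union> {[a, 2] | a. 2 \<le> a \<and> a \<le> 4} \<union> {[2, 2, 2]}"

end

theory Submission
  imports Defs "HOL-Algebra.Multiplicative_Group"
begin

text \<open>Let \<open>z\<close> be a central element of maximal order among those whose order is coprime to the index of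
  \<open>N = \<langle>z\<rangle>\<close>. The transfer into \<open>N\<close> splits \<open>G\<close> as \<open>N \<times> S\<close>, and \<open>S\<close> has no central cyclic Sylow
  subgroup, since a generator of one, multiplied by \<open>z\<close>, would contradict maximality. Splitting \<open>N\<close>
  according to the primes that divide its order exactly once and the others gives \<open>A \<times> C\<close>.

  Since \<open>cyc\<close> is multiplicative on products of groups of coprime orders and counts divisors on cyclic
  groups, \<open>\<eta>(A \<times> S \<times> C) = \<eta>(S) \<delta>(C)\<close>, which gives the inequality in both directions. For trivial
  \<open>S\<close> it reads \<open>\<Prod>(a\<^sub>i + 1) < 4 \<cdot> 2\<^sup>r\<close> with all \<open>a\<^sub>i \<ge> 2\<close>; this forces \<open>3\<^sup>r < 4 \<cdot> 2\<^sup>r\<close>, hence \<open>r \<le> 3\<close>.\<close>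

section \<open>Divisor counts and prime exponents\<close>

text \<open>Divisors of \<open>m * n\<close> are products \<open>a * b\<close> with \<open>a\<close>
  dividing \<open>m\<close> and \<open>b\<close> dividing \<open>n\<close>. Coprimality makes the
  pair unique: from \<open>a * b = a' * b'\<close>, the factor \<open>a\<close> divides
  \<open>a' * b'\<close> and is coprime to \<open>b'\<close>, hence divides \<open>a'\<close>, and
  symmetrically.\<close>

lemma card_divisors_mult_coprime:
  fixes m n :: nat
  assumes "coprime m n"
  shows "card {d. d dvd m * n} = card {d. d dvd m} * card {d. d dvd n}"
proof -
  have "inj_on (\<lambda>(a, b). a * b) ({d. d dvd m} \<times> {d. d dvd n})"
  proof (rule inj_onI, clarsimp)
    fix a b a' b' assume *: "a dvd m" "b dvd n" "a' dvd m" "b' dvd n" "a * b = a' * b'"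
    have "a dvd a' * b'" "a' dvd a * b" "b dvd a' * b'" "b' dvd a * b"
      using *(5) by (metis dvd_triv_left dvd_triv_right)+
    moreover have "coprime a b'" "coprime a' b" "coprime b a'" "coprime b' a"
      using * assms by (meson coprime_divisors coprime_commute)+
    ultimately show "a = a' \<and> b = b'"
      by (metis coprime_dvd_mult_left_iff coprime_dvd_mult_right_iff dvd_antisym)
  qed
  moreover have "(\<lambda>(a, b). a * b) ` ({d. d dvd m} \<times> {d. d dvd n}) = {d. d dvd m * n}"
    by (auto intro: mult_dvd_mono simp: image_iff) (metis division_decomp)
  ultimately show ?thesis
    by (metis card_cartesian_product card_image)
qed

lemma card_divisors_prime_power:
  fixes p :: nat
  assumes "prime p"
  shows "card {d. d dvd p ^ k} = Suc k"
proof -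
  have "{d. d dvd p ^ k} = (\<lambda>i. p ^ i) ` {..k}"
    using assms by (auto simp: divides_primepow_nat le_imp_power_dvd)
  moreover have "inj_on (\<lambda>i. p ^ i) {..k}"
    using prime_gt_1_nat[OF assms] by (auto intro!: inj_onI)
  ultimately show ?thesis
    by (simp add: card_image)
qed

lemma card_divisors_prod_prime_powers:
  fixes P :: "nat set"
  assumes "finite P" "\<And>p. p \<in> P \<Longrightarrow> prime p"
  shows "card {d. d dvd (\<Prod>p\<in>P. p ^ f p)} = (\<Prod>p\<in>P. Suc (f p))"
  using assms
proof (induction P)
  case (insert q P)
  have "coprime (q ^ f q) (\<Prod>p\<in>P. p ^ f p)"
    using insert.hyps insert.prems
    by (intro prod_coprime_right) (metis coprime_power_left_iff coprime_power_right_iff insert_iff primes_coprime)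
  then show ?case
    using insert by (simp add: card_divisors_mult_coprime card_divisors_prime_power)
qed auto

lemma card_divisors:
  fixes n :: nat
  assumes "n > 0"
  shows "card {d. d dvd n} = (\<Prod>p\<in>prime_factors n. Suc (multiplicity p n))"
  using card_divisors_prod_prime_powers[of "prime_factors n" "\<lambda>p. multiplicity p n"] assms
  by (simp add: prime_factorization_nat[symmetric] in_prime_factors_imp_prime)

lemma card_divisors_ge:
  fixes n :: nat
  assumes "n > 0"
  shows "2 ^ card (prime_factors n) \<le> card {d. d dvd n}"
proof -
  have "(\<Prod>p\<in>prime_factors n. 2) \<le> (\<Prod>p\<in>prime_factors n. Suc (multiplicity p n))"
    by (rule prod_mono) (auto simp: prime_factors_multiplicity)
  then show ?thesis
    using assms by (simp add: card_divisors)
qed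

text \<open>Every exponent is 1, so each prime contributes a factor 2. This is why the squarefree
  cyclic factor has no influence on the threshold.\<close>

lemma card_divisors_squarefree:
  fixes n :: nat
  assumes "squarefree n"
  shows "card {d. d dvd n} = 2 ^ card (prime_factors n)"
proof -
  have "n > 0"
    using assms by (auto intro: Nat.gr0I)
  then show ?thesis
    using assms by (simp add: card_divisors squarefree_factorial_semiring' numeral_2_eq_2)
qed

lemma card_prime_factors_mult_coprime:
  fixes m n :: nat
  assumes "coprime m n" "m > 0" "n > 0"
  shows "card (prime_factors (m * n)) = card (prime_factors m) + card (prime_factors n)"
proof -
  have "prime_factors m \<inter> prime_factors n = {}"
    using assms by (auto simp: prime_factors_dvd) (metis coprime_common_divisor not_prime_unit)
  then show ?thesis
    using assms by (simp add: prime_factors_product card_Un_disjoint)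
qed

text \<open>The primes are separated by whether their exponent is 1. Applied to the order of the
  central element \<open>z\<close>, this yields the orders of the two cyclic factors.\<close>

lemma squarefree_squareful_decomposition:
  fixes n :: nat
  assumes "n > 0"
  obtains a c where "n = a * c" "coprime a c" "squarefree a"
    "\<And>p. p \<in> prime_factors c \<Longrightarrow> 2 \<le> multiplicity p c"
proof -
  define P where "P = {p \<in> prime_factors n. multiplicity p n = 1}"
  define Q where "Q = prime_factors n - P"
  define a where "a = \<Prod>P"
  define c where "c = (\<Prod>p\<in>Q. p ^ multiplicity p n)"
  have fin: "finite P" "finite Q" and pr: "\<And>p. p \<in> P \<Longrightarrow> prime p" "\<And>p. p \<in> Q \<Longrightarrow> prime p"
    by (auto simp: P_def Q_def)
  have "n = (\<Prod>p\<in>P \<union> Q. p ^ multiplicity p n)"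
    using assms by (simp add: P_def Q_def prime_factorization_nat[symmetric] Un_absorb1)
  also have "\<dots> = (\<Prod>p\<in>P. p ^ multiplicity p n) * c"
    using fin by (subst prod.union_disjoint) (auto simp: Q_def c_def)
  also have "(\<Prod>p\<in>P. p ^ multiplicity p n) = a"
    unfolding a_def by (rule prod.cong) (auto simp: P_def)
  finally have "n = a * c" .
  moreover have "coprime a c"
    unfolding a_def c_def
  proof (intro prod_coprime_left prod_coprime_right)
    fix p q assume "p \<in> P" "q \<in> Q"
    then have "p \<noteq> q" "prime p" "prime q"
      using pr by (auto simp: Q_def)
    then show "coprime p (q ^ multiplicity q n)"
      by (simp add: primes_coprime)
  qed
  moreover have "squarefree a"
    unfolding a_def using pr
    by (intro squarefree_prod_coprime) (auto simp: primes_coprime squarefree_prime)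
  moreover have "2 \<le> multiplicity p c" if "p \<in> prime_factors c" for p
  proof -
    have "prime p" "0 < multiplicity p c"
      using that by (auto simp: prime_factors_multiplicity)
    then have "p \<in> Q" "multiplicity p c = multiplicity p n"
      unfolding c_def using fin pr by (auto simp: multiplicity_prod_prime_powers split: if_splits)
    then show ?thesis
      by (auto simp: Q_def P_def prime_factors_multiplicity)
  qed
  ultimately show thesis
    using that by blast
qed

text \<open>Unique factorization: the product alone recovers the primes and their exponents, so a
  primary decomposition can be read off from the order of the group.\<close>

lemma prod_prime_power_list:
  fixes ls as :: "nat list"
  assumes "length ls = length as" "distinct ls" "\<forall>l \<in> set ls. prime l" "\<forall>a \<in> set as. 1 \<le> a"
  defines "n \<equiv> (\<Prod>i<length as. ls ! i ^ as ! i)"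
  shows "prime_factors n = set ls" "as = map (\<lambda>p. multiplicity p n) ls"
proof -
  \<comment> \<open>\<open>f\<close> looks up the exponent at the position of \<open>p\<close> in
    \<open>ls\<close>, which is unique because \<open>ls\<close> is distinct. The product over
    positions thus becomes a product over the set of primes.\<close>
  define f where "f p = as ! the_inv_into {..<length ls} ((!) ls) p" for p
  have bij: "bij_betw ((!) ls) {..<length ls} (set ls)"
    using assms by (simp add: bij_betw_nth)
  have f: "f (ls ! i) = as ! i" if "i < length ls" for i
    using bij that by (simp add: f_def bij_betw_def the_inv_into_f_f)
  have n: "n = (\<Prod>p\<in>set ls. p ^ f p)"
    unfolding n_def using prod.reindex_bij_betw[OF bij, of "\<lambda>p. p ^ f p"] assms(1) f by simp
  have mult: "multiplicity p n = (if p \<in> set ls then f p else 0)" if "prime p" for p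
    unfolding n using that assms(3) by (intro multiplicity_prod_prime_powers) auto
  have pos: "f p > 0" if "p \<in> set ls" for p
    using that f assms(1,4) by (force simp: in_set_conv_nth)
  show "prime_factors n = set ls"
    using mult pos assms(3) by (auto simp: prime_factors_multiplicity split: if_splits)
  show "as = map (\<lambda>p. multiplicity p n) ls"
    using assms(1,3) f mult by (intro nth_equalityI) auto
qed

lemma prod_prime_power_list_multiplicity:
  fixes n :: nat
  assumes "n > 0" "distinct ls" "set ls = prime_factors n"
  shows "(\<Prod>i<length ls. ls ! i ^ (map (\<lambda>p. multiplicity p n) ls) ! i) = n"
proof -
  have "bij_betw ((!) ls) {..<length ls} (set ls)"
    using assms by (simp add: bij_betw_nth)
  from prod.reindex_bij_betw[OF this, of "\<lambda>p. p ^ multiplicity p n"] show ?thesis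
    using assms by (simp add: prime_factorization_nat[symmetric])
qed

section \<open>Exponent patterns below the threshold\<close>

lemma power_length_le_prod_list:
  fixes xs :: "nat list"
  assumes "\<forall>x \<in> set xs. k \<le> x"
  shows "k ^ length xs \<le> prod_list xs"
  using assms by (induction xs) (auto intro: mult_le_mono)

text \<open>The right-hand side is the condition \<open>delta C < 4\<close> with denominators
  cleared. For one exponent it reads \<open>a + 1 < 8\<close>; the longer lists are treated
  below.\<close>

lemma threshold_patterns_iff:
  assumes "sorted_wrt (\<ge>) as"
  shows "as \<in> threshold_patterns \<longleftrightarrow>
    (\<forall>a \<in> set as. 2 \<le> a) \<and> prod_list (map Suc as) < 4 * 2 ^ length as"
proof
  assume "as \<in> threshold_patterns"
  then show "(\<forall>a \<in> set as. 2 \<le> a) \<and> prod_list (map Suc as) < 4 * 2 ^ length as"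
    by (auto simp: threshold_patterns_def)
next
  assume *: "(\<forall>a \<in> set as. 2 \<le> a) \<and> prod_list (map Suc as) < 4 * 2 ^ length as"
  have "3 ^ length as < (4::nat) * 2 ^ length as"
    using * power_length_le_prod_list[of "map Suc as" 3] by force
  have "length as < 4"
  proof (rule ccontr)
    \<comment> \<open>Already \<open>3 ^ 4 = 81\<close> exceeds \<open>4 * 2 ^ 4 = 64\<close>, and
      each further entry multiplies the left side by 3 but the right side only by 2.\<close>
    assume "\<not> length as < 4"
    then obtain m where "length as = 4 + m"
      using le_Suc_ex by (metis not_less)
    moreover have "(2::nat) ^ m \<le> 3 ^ m"
      by (rule power_mono) auto
    ultimately show False
      using \<open>3 ^ length as < 4 * 2 ^ length as\<close> by (simp add: power_add)
  qed
  then consider "as = []" | a where "as = [a]" | a b where "as = [a, b]" | a b c where "as = [a, b, c]"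
    by (auto simp: less_Suc_eq numeral_eq_Suc length_Suc_conv)
  then show "as \<in> threshold_patterns"
  proof cases
    case 3
    \<comment> \<open>If \<open>b\<close> were at least 3, so would be \<open>a\<close> by the
      ordering, and the product would reach the bound 16. With \<open>b = 2\<close> the condition
      \<open>3 * (a + 1) < 16\<close> leaves \<open>a\<close> at most 4.\<close>
    have "b < 3"
    proof (rule ccontr)
      assume "\<not> b < 3"
      then have "4 * 4 \<le> Suc a * Suc b"
        using * 3 assms by (intro mult_le_mono) auto
      then show False
        using * 3 by simp
    qed
    then have "b = 2"
      using * 3 by simp
    then show ?thesis
      using * 3 by (auto simp: threshold_patterns_def)
  next
    case 4
    \<comment> \<open>The bound is 32 here, while \<open>a\<close> at least 3 would give at least
      36. As \<open>a\<close> is the largest entry, all three are 2.\<close>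
    have "a < 3"
    proof (rule ccontr)
      assume "\<not> a < 3"
      then have "4 * (3 * 3) \<le> Suc a * (Suc b * Suc c)"
        using * 4 by (intro mult_le_mono) auto
      then show False
        using * 4 by simp
    qed
    then have "a = 2" "b = 2" "c = 2"
      using * 4 assms by auto
    then show ?thesis
      using 4 by (simp add: threshold_patterns_def)
  qed (use * in \<open>auto simp: threshold_patterns_def\<close>)
qed

section \<open>Counting cyclic subgroups\<close>

text \<open>Replaces the predicate on restricted records by the image of the map from elements to
  generated subgroups, on which all later counting takes place.\<close>

lemma (in group) cyclic_subgroups_eq:
  "{H. subgroup H G \<and> cyclic_group (G\<lparr>carrier := H\<rparr>)} = (\<lambda>x. generate G {x}) ` carrier G"
proof (intro equalityI subsetI)
  fix H assume "H \<in> {H. subgroup H G \<and> cyclic_group (G\<lparr>carrier := H\<rparr>)}"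
  then have H: "subgroup H G" and cyc: "cyclic_group (G\<lparr>carrier := H\<rparr>)"
    by auto
  then obtain x where x: "x \<in> H" "subgroup_generated (G\<lparr>carrier := H\<rparr>) {x} = G\<lparr>carrier := H\<rparr>"
    by (auto simp: cyclic_group_def)
  have "generate (G\<lparr>carrier := H\<rparr>) {x} = H"
    using arg_cong[OF x(2), of carrier] x(1) by (simp add: carrier_subgroup_generated)
  then have "generate G {x} = H"
    using H x(1) by (simp add: generate_consistent)
  then show "H \<in> (\<lambda>x. generate G {x}) ` carrier G"
    using H x(1) subgroup.mem_carrier by fast
next
  fix H assume "H \<in> (\<lambda>x. generate G {x}) ` carrier G"
  then obtain x where x: "x \<in> carrier G" "H = generate G {x}"
    by auto
  have "subgroup_generated G {x} = G\<lparr>carrier := H\<rparr>"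
    using x by (simp add: subgroup_generated_def)
  then show "H \<in> {H. subgroup H G \<and> cyclic_group (G\<lparr>carrier := H\<rparr>)}"
    using x cyclic_group_generated[of x] generate_is_subgroup[of "{x}"] by simp
qed

lemma cyc_eq:
  assumes "group G"
  shows "cyc G = card ((\<lambda>x. generate G {x}) ` carrier G)"
  using assms by (simp add: cyc_def group.cyclic_subgroups_eq)

lemma cyc_iso:
  assumes "group G" "group H" "G \<cong> H"
  shows "cyc G = cyc H"
proof -
  obtain f where f: "f \<in> iso G H"
    using assms by (auto simp: is_iso_def)
  then interpret f: group_hom G H f
    using assms by (simp add: group_hom_def group_hom_axioms_def iso_imp_homomorphism)
  have inj: "inj_on f (carrier G)" and img: "f ` carrier G = carrier H"
    using f by (auto simp: iso_def bij_betw_def)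
  have "(\<lambda>x. generate H {x}) ` carrier H = (\<lambda>x. generate H {f x}) ` carrier G"
    by (simp flip: img add: image_image)
  also have "\<dots> = (`) f ` (\<lambda>x. generate G {x}) ` carrier G"
    using f.generate_img[of "{_}"] by (auto simp: image_image)
  finally have "cyc H = card ((`) f ` (\<lambda>x. generate G {x}) ` carrier G)"
    using assms by (simp add: cyc_eq)
  also have "\<dots> = card ((\<lambda>x. generate G {x}) ` carrier G)"
  \<comment> \<open>Generated subgroups are subsets of the carrier, and taking images under the
    injective \<open>f\<close> is injective on such subsets.\<close>
  proof (rule card_image, rule inj_on_subset[OF inj_on_image_Pow[OF inj]])
    show "(\<lambda>x. generate G {x}) ` carrier G \<subseteq> Pow (carrier G)"
      using f.G.generate_incl by auto
  qed
  finally show ?thesis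
    using assms by (simp add: cyc_eq)
qed

lemma pow_DirProd:
  "(x, y) [^]\<^bsub>G \<times>\<times> H\<^esub> (k::nat) = (x [^]\<^bsub>G\<^esub> k, y [^]\<^bsub>H\<^esub> k)"
  by (induction k) (auto simp: nat_pow_def)

lemma order_DirProd: "order (G \<times>\<times> H) = order G * order H"
  by (simp add: order_def card_cartesian_product)

text \<open>By coprimality the order of \<open>(x, y)\<close> is the product of the two orders. The
  subgroup it generates lies in the product of the two cyclic subgroups and has the same finite
  size.\<close>

lemma generate_DirProd_coprime:
  assumes "group G" "group H" "finite (carrier G)" "finite (carrier H)"
    and "coprime (order G) (order H)" and x: "x \<in> carrier G" and y: "y \<in> carrier H"
  shows "generate (G \<times>\<times> H) {(x, y)} = generate G {x} \<times> generate H {y}"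
proof -
  interpret G: group G by fact
  interpret H: group H by fact
  interpret GH: group "G \<times>\<times> H" using assms by (simp add: DirProd_group)
  have "coprime (G.ord x) (H.ord y)"
    using assms G.ord_dvd_group_order H.ord_dvd_group_order by (meson coprime_divisors)
  then have "GH.ord (x, y) = G.ord x * H.ord y"
    using x y
    by (subst GH.ord_unique)
      (auto simp: pow_DirProd G.pow_eq_id H.pow_eq_id divides_mult dest: dvd_mult_left dvd_mult_right)
  then have card: "card (generate (G \<times>\<times> H) {(x, y)}) = card (generate G {x} \<times> generate H {y})"
    using x y by (simp add: card_cartesian_product flip: G.generate_pow_card H.generate_pow_card GH.generate_pow_card)
  have "generate (G \<times>\<times> H) {(x, y)} \<subseteq> generate G {x} \<times> generate H {y}"
    using x y assms G.generate_is_subgroup[of "{x}"] H.generate_is_subgroup[of "{y}"]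
    by (intro GH.generate_subgroup_incl DirProd_subgroups) (auto intro: generate.incl)
  moreover have "finite (generate G {x} \<times> generate H {y})"
    using x y assms G.generate_incl[of "{x}"] H.generate_incl[of "{y}"]
    by (simp add: finite_subset)
  ultimately show ?thesis
    using card by (simp add: card_subset_eq)
qed

lemma cyc_DirProd_coprime:
  assumes "group G" "group H" "finite (carrier G)" "finite (carrier H)"
    and "coprime (order G) (order H)"
  shows "cyc (G \<times>\<times> H) = cyc G * cyc H"
proof -
  let ?cG = "(\<lambda>x. generate G {x}) ` carrier G" and ?cH = "(\<lambda>x. generate H {x}) ` carrier H"
  have "(\<lambda>z. generate (G \<times>\<times> H) {z}) ` carrier (G \<times>\<times> H) =
      (\<lambda>(x, y). generate G {x} \<times> generate H {y}) ` (carrier G \<times> carrier H)"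
    using assms by (intro image_cong) (auto simp: generate_DirProd_coprime)
  also have "\<dots> = (\<lambda>(K, L). K \<times> L) ` (?cG \<times> ?cH)"
    by (auto simp: image_iff)
  finally have "cyc (G \<times>\<times> H) = card ((\<lambda>(K, L). K \<times> L) ` (?cG \<times> ?cH))"
    using assms by (simp add: cyc_eq DirProd_group)
  \<comment> \<open>A product of nonempty sets determines its factors, and generated subgroups
    contain the identity.\<close>
  also have "inj_on (\<lambda>(K, L). K \<times> L) (?cG \<times> ?cH)"
  proof (rule inj_onI, clarify)
    fix x y x' y'
    assume "generate G {x} \<times> generate H {y} = generate G {x'} \<times> generate H {y'}"
    moreover have "generate G {x} \<noteq> {}" "generate H {y} \<noteq> {}"
      using generate.one by blast+
    ultimately show "generate G {x} = generate G {x'} \<and> generate H {y} = generate H {y'}"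
      by (simp add: times_eq_iff)
  qed
  ultimately show ?thesis
    using assms by (simp add: card_image card_cartesian_product cyc_eq)
qed

lemma num_primes_DirProd_coprime:
  assumes "finite (carrier G)" "finite (carrier H)" "group G" "group H"
    and "coprime (order G) (order H)"
  shows "num_primes (G \<times>\<times> H) = num_primes G + num_primes H"
  using assms
  by (simp add: num_primes_def order_DirProd card_prime_factors_mult_coprime
      group.is_monoid monoid.order_gt_0_iff_finite)

lemma (in group) cyclic_groupE:
  assumes "finite (carrier G)" "cyclic_group G"
  obtains g where "g \<in> carrier G" "carrier G = generate G {g}" "ord g = order G"
proof -
  obtain g where "g \<in> carrier G" "subgroup_generated G {g} = G"
    using assms by (auto simp: cyclic_group_def)
  then show thesis
    using that carrier_subgroup_generated[of G "{g}"] cyclic_order_is_ord[of g] by simp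
qed

text \<open>With a generator \<open>g\<close> and \<open>n = order G\<close>, the cyclic subgroups
  are those generated by \<open>g [^] (n div d)\<close> for the divisors \<open>d\<close> of
  \<open>n\<close>. The size of this subgroup is \<open>d\<close>, so different divisors give
  different subgroups.\<close>

lemma cyc_cyclic:
  fixes G (structure)
  assumes "group G" "finite (carrier G)" "cyclic_group G"
  shows "cyc G = card {d. d dvd order G}"
proof -
  interpret group G by fact
  obtain g where g: "g \<in> carrier G" "carrier G = generate G {g}" "ord g = order G"
    using cyclic_groupE[OF assms(2,3)] .
  define n where "n = order G"
  have n: "n > 0" "ord g = n"
    using assms g by (simp_all add: n_def order_gt_0_iff_finite)
  let ?C = "\<lambda>d. generate G {g [^] (n div d)}"
  have card: "card (?C d) = d" if "d dvd n" for d
  proof -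
    have "n div d dvd n" "n div d \<noteq> 0" "n div (n div d) = d"
      using that n by (auto simp: dvd_div_eq_0_iff)
    then show ?thesis
      using g(1) n by (simp add: ord_pow flip: generate_pow_card)
  qed
  \<comment> \<open>Writing \<open>x\<close> as the \<open>k\<close>-th power of \<open>g\<close>,
    \<open>n\<close> divides \<open>k * ord x\<close>, so \<open>k\<close> is a multiple of
    \<open>n div ord x\<close>. This puts \<open>x\<close> into \<open>?C (ord x)\<close>, and both
    subgroups have \<open>ord x\<close> elements.\<close>
  have "generate G {x} = ?C (ord x)" if x: "x \<in> carrier G" for x
  proof -
    have d: "ord x dvd n"
      using x by (simp add: n_def ord_dvd_group_order)
    obtain k :: nat where k: "x = g [^] k"
      using x g(1) generate_pow_on_finite_carrier[OF assms(2) g(1)] by (auto simp: g(2))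
    have "n dvd k * ord x"
      using pow_ord_eq_1[OF x] g(1) n(2) k by (metis nat_pow_pow pow_eq_id)
    then have "n div ord x dvd k"
      using d n by (metis div_dvd_iff_mult dvd_pos_nat neq0_conv)
    then obtain j where j: "k = n div ord x * j" ..
    have "x = (g [^] (n div ord x)) [^] j"
      using g(1) k j by (metis nat_pow_pow)
    then have "x \<in> ?C (ord x)"
      using g(1) generate_pow_on_finite_carrier[OF assms(2), of "g [^] (n div ord x)"] by blast
    then have sub: "generate G {x} \<subseteq> ?C (ord x)"
      using g(1) by (intro generate_subgroup_incl generate_is_subgroup) auto
    moreover have "finite (?C (ord x))"
      using g(1) assms(2) by (auto intro: finite_subset[OF generate_incl])
    ultimately show ?thesis
      using card[OF d] generate_pow_card[OF x] by (metis card_subset_eq)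
  qed
  moreover have "?C d \<in> (\<lambda>x. generate G {x}) ` carrier G" for d
    using g(1) by auto
  moreover have "\<exists>x\<in>carrier G. ord x = d" if "d dvd n" for d
    using card[OF that] g(1) generate_pow_card by (metis nat_pow_closed)
  ultimately have "(\<lambda>x. generate G {x}) ` carrier G = ?C ` {d. d dvd n}"
    by (auto simp: image_iff n_def ord_dvd_group_order)
  moreover have "inj_on ?C {d. d dvd n}"
    using card by (metis (mono_tags, lifting) inj_onI mem_Collect_eq)
  ultimately show ?thesis
    using assms by (simp add: cyc_eq card_image n_def)
qed

section \<open>Finite cyclic groups and their primary decompositions\<close>

lemma iso_if_card_eq:
  assumes "f \<in> hom G H" "inj_on f (carrier G)" "finite (carrier H)"
    and "card (carrier H) = card (carrier G)"
  shows "f \<in> iso G H"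
proof -
  have "f ` carrier G = carrier H"
    using assms by (intro card_subset_eq) (auto simp: hom_def card_image)
  then show ?thesis
    using assms by (simp add: iso_iff)
qed

lemma prod_dvd_if_coprime:
  fixes f :: "'a \<Rightarrow> 'b :: semiring_gcd"
  assumes "finite I" "\<And>i. i \<in> I \<Longrightarrow> f i dvd x"
    and "\<And>i j. i \<in> I \<Longrightarrow> j \<in> I \<Longrightarrow> i \<noteq> j \<Longrightarrow> coprime (f i) (f j)"
  shows "(\<Prod>i\<in>I. f i) dvd x"
  using assms
proof (induction I)
  case (insert i I)
  have "coprime (f i) (\<Prod>i\<in>I. f i)"
    using insert.hyps insert.prems by (intro prod_coprime_right) auto
  then show ?case
    using insert by (auto intro: divides_mult)
qed auto

lemma order_integer_mod_group: "order (integer_mod_group n) = n"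
  by (simp add: order_def carrier_integer_mod_group)

text \<open>Chinese remainder theorem. Reduction modulo all \<open>n i\<close> is injective since
  pairwise coprime divisors of \<open>x - y\<close> have a product dividing it; comparing sizes
  gives surjectivity.\<close>

lemma integer_mod_group_prod_iso:
  assumes "finite I" and pos: "\<And>i. i \<in> I \<Longrightarrow> n i > 0"
    and coprime: "\<And>i j. i \<in> I \<Longrightarrow> j \<in> I \<Longrightarrow> i \<noteq> j \<Longrightarrow> coprime (n i) (n j)"
  shows "integer_mod_group (\<Prod>i\<in>I. n i) \<cong> product_group I (\<lambda>i. integer_mod_group (n i))"
proof -
  define N where "N = (\<Prod>i\<in>I. n i)"
  have N: "N > 0"
    using pos by (auto simp: N_def intro: prod_pos)
  have dvd: "int (n i) dvd int N" if "i \<in> I" for i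
    using that assms(1) unfolding N_def int_dvd_int_iff by (rule dvd_prodI[rotated])
  \<comment> \<open>The restriction to \<open>I\<close> is needed because elements of
    \<open>product_group\<close> are extensional functions.\<close>
  define f where "f x = (\<lambda>i\<in>I. x mod int (n i))" for x
  let ?Z = "integer_mod_group N" and ?P = "product_group I (\<lambda>i. integer_mod_group (n i))"
  have "f \<in> hom ?Z ?P"
    using N pos dvd
    by (intro homI) (auto simp: f_def carrier_integer_mod_group mod_mod_cancel mod_add_eq fun_eq_iff)
  moreover have "inj_on f (carrier ?Z)"
  proof (rule inj_onI)
    fix x y assume xy: "x \<in> carrier ?Z" "y \<in> carrier ?Z" "f x = f y"
    have "int (n i) dvd x - y" if "i \<in> I" for i
      using that fun_cong[OF xy(3), of i] by (simp add: f_def mod_eq_dvd_iff)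
    then have "(\<Prod>i\<in>I. int (n i)) dvd x - y"
      using assms(1) coprime by (intro prod_dvd_if_coprime) auto
    then have "x mod int N = y mod int N"
      by (simp add: N_def mod_eq_dvd_iff)
    then show "x = y"
      using xy N by (simp add: carrier_integer_mod_group)
  qed
  moreover have "card (carrier ?P) = card (carrier ?Z)"
    using assms(1) by (simp add: card_PiE order_integer_mod_group N_def flip: order_def)
  moreover have "finite (carrier ?P)"
    using pos assms(1) by (auto intro!: finite_PiE simp: carrier_integer_mod_group)
  ultimately have "f \<in> iso ?Z ?P"
    by (intro iso_if_card_eq)
  then show ?thesis
    unfolding N_def is_iso_def by blast
qed

lemma (in group) cyclic_group_iso_integer_mod_group:
  assumes "finite (carrier G)" "cyclic_group G"
  shows "integer_mod_group (order G) \<cong> G"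
proof -
  obtain g where g: "g \<in> carrier G" "carrier G = generate G {g}" "ord g = order G"
    using cyclic_groupE[OF assms] .
  have pos: "order G > 0"
    using assms by (simp add: order_gt_0_iff_finite)
  let ?Z = "integer_mod_group (order G)" and ?f = "\<lambda>k::int. g [^] k"
  \<comment> \<open>Addition in \<open>?Z\<close> reduces modulo \<open>order G\<close>. Powers of
    \<open>g\<close> do not see this reduction, as \<open>g\<close> has exactly that order, so
    taking powers is a homomorphism.\<close>
  have mod: "g [^] (k mod int (order G)) = g [^] k" for k :: int
    using g by (simp add: int_pow_eq mod_eq_dvd_iff[symmetric])
  have "?f \<in> hom ?Z G"
    using g(1) by (intro homI) (simp_all add: mod int_pow_mult)
  moreover have "inj_on ?f (carrier ?Z)"
    using g pos
    by (intro inj_onI) (auto simp: int_pow_eq carrier_integer_mod_group simp flip: mod_eq_dvd_iff)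
  moreover have "?f ` carrier ?Z = carrier G"
  proof -
    have "x \<in> ?f ` carrier ?Z" if "x \<in> carrier G" for x
    proof -
      have "x \<in> generate G {g}"
        using that g(2) by simp
      then obtain k :: int where "x = g [^] k"
        unfolding generate_pow[OF g(1)] by blast
      then have "x = g [^] (k mod int (order G))"
        by (simp add: mod)
      then show ?thesis
        using pos by (auto simp: carrier_integer_mod_group)
    qed
    then show ?thesis
      using g(1) by auto
  qed
  ultimately show ?thesis
    unfolding is_iso_def iso_def bij_betw_def by blast
qed

lemma finite_integer_mod_group: "n > 0 \<Longrightarrow> finite (carrier (integer_mod_group n))"
  by (simp add: carrier_integer_mod_group)

lemma cyclic_integer_mod_group: "cyclic_group (integer_mod_group n)"
\<comment> \<open>The generator used is 1, which is not in the carrier when \<open>n = 1\<close>: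
  there the only element is 0.\<close>
proof (cases "n = 1")
  case True
  then show ?thesis
    by (simp add: trivial_integer_mod_group trivial_imp_cyclic_group)
next
  case False
  have "x \<in> range (\<lambda>k::int. 1 [^]\<^bsub>integer_mod_group n\<^esub> k)" if "x \<in> carrier (integer_mod_group n)" for x
    using that by (auto simp: int_pow_integer_mod_group carrier_integer_mod_group image_iff intro!: exI[of _ x] split: if_splits)
  then have "carrier (integer_mod_group n) = range (\<lambda>k::int. 1 [^]\<^bsub>integer_mod_group n\<^esub> k)"
    using False by (auto simp: group.int_pow_closed)
  then show ?thesis
    using False group.cyclic_group[OF group_integer_mod_group] integer_mod_group_1 by blast
qed

lemma order_primary_decomposition:
  assumes "primary_decomposition C ls as"
  shows "order C = (\<Prod>i<length as. ls ! i ^ as ! i)"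
proof -
  have "order C = order (product_group {..<length as} (\<lambda>i. integer_mod_group (ls ! i ^ as ! i)))"
    using assms by (auto simp: primary_decomposition_def is_iso_def dest: iso_same_order)
  also have "\<dots> = (\<Prod>i<length as. order (integer_mod_group (ls ! i ^ as ! i)))"
    by (simp add: order_def card_PiE)
  finally show ?thesis
    by (simp add: order_integer_mod_group)
qed

text \<open>Up to the listing of the primes, a primary decomposition is determined by the order of
  \<open>C\<close>. A condition on all decompositions therefore becomes one on the multiplicities in
  \<open>order C\<close>.\<close>

lemma primary_decompositionD:
  assumes "primary_decomposition C ls as"
  shows "distinct ls" "set ls = prime_factors (order C)"
    "as = map (\<lambda>p. multiplicity p (order C)) ls"
  using assms order_primary_decomposition[OF assms] prod_prime_power_list[of ls as]
  by (auto simp: primary_decomposition_def)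

text \<open>Follows from the Chinese remainder theorem. The enumeration \<open>ls\<close> is
  arbitrary so that prescribed lists of primes can be realized in their given order.\<close>

lemma primary_decompositionI:
  assumes "group C" "finite (carrier C)" "cyclic_group C"
    and ls: "distinct ls" "set ls = prime_factors (order C)"
  shows "primary_decomposition C ls (map (\<lambda>p. multiplicity p (order C)) ls)"
proof -
  interpret group C by fact
  let ?as = "map (\<lambda>p. multiplicity p (order C)) ls"
  have pos: "order C > 0"
    using assms by (simp add: order_gt_0_iff_finite)
  have pr: "prime (ls ! i)" if "i < length ls" for i
    using that ls(2) nth_mem by fastforce
  have "integer_mod_group (order C) \<cong> product_group {..<length ls} (\<lambda>i. integer_mod_group (ls ! i ^ ?as ! i))"
    using integer_mod_group_prod_iso[of "{..<length ls}" "\<lambda>i. ls ! i ^ ?as ! i"] pr ls(1)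
    by (simp add: prod_prime_power_list_multiplicity[OF pos ls] primes_coprime nth_eq_iff_index_eq
        prime_gt_0_nat del: nth_map)
  moreover have "C \<cong> integer_mod_group (order C)"
    using assms by (simp add: group.iso_sym cyclic_group_iso_integer_mod_group)
  ultimately have "C \<cong> product_group {..<length ls} (\<lambda>i. integer_mod_group (ls ! i ^ ?as ! i))"
    by (metis iso_trans)
  then show ?thesis
    using ls by (auto simp: primary_decomposition_def prime_factors_multiplicity)
qed

lemma delta_primary_decomposition:
  assumes "primary_decomposition C ls as" "order C > 0"
  shows "delta C = real (prod_list (map Suc as)) / 2 ^ length as"
proof -
  note pd = primary_decompositionD[OF assms(1)]
  have "(\<Prod>p\<in>prime_factors (order C). Suc (multiplicity p (order C))) = prod_list (map Suc as)"
    using pd by (simp add: prod.distinct_set_conv_list o_def flip: pd(2))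
  moreover have "card (prime_factors (order C)) = length as"
    using pd by (simp add: distinct_card flip: pd(2))
  ultimately show ?thesis
    using assms(2) by (simp add: delta_def num_primes_def card_divisors)
qed

text \<open>Lets the bound on \<open>eta S * delta C\<close> pass to \<open>eta S\<close> alone, as
  the definition of a fundamental block demands.\<close>

lemma delta_ge_1:
  assumes "group C" "finite (carrier C)"
  shows "1 \<le> delta C"
proof -
  have "order C > 0"
    using assms by (simp add: group.is_monoid monoid.order_gt_0_iff_finite)
  then have "(2::nat) ^ num_primes C \<le> card {d. d dvd order C}"
    unfolding num_primes_def by (rule card_divisors_ge)
  then have "real (2 ^ num_primes C) \<le> real (card {d. d dvd order C})"
    by (rule of_nat_mono)
  then show ?thesis
    by (simp add: delta_def)
qed

section \<open>The threshold as a condition on eta and delta\<close>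

lemma eta_trivial:
  assumes "trivial_group S"
  shows "eta S = 1"
proof -
  have "group S" and c: "carrier S = {\<one>\<^bsub>S\<^esub>}"
    using assms by (auto simp: trivial_group_def)
  then have "cyc S = 1" "order S = 1"
    by (simp_all add: cyc_eq order_def)
  then show ?thesis
    by (simp add: eta_def num_primes_def)
qed

text \<open>Both sides are multiplicative over coprime factors. \<open>A\<close> contributes the
  same power of two to each and cancels; dividing by the powers of two coming from \<open>S\<close>
  and \<open>C\<close> leaves the product of \<open>eta\<close> and \<open>delta\<close>.\<close>

lemma cyc_threshold_iff:
  fixes A :: "'a monoid" and S :: "'b monoid" and C :: "'c monoid"
  assumes A: "group A" "finite (carrier A)" "cyclic_group A" "squarefree (order A)"
    and S: "group S" "finite (carrier S)"
    and C: "group C" "finite (carrier C)" "cyclic_group C"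
    and coprime: "coprime (order A) (order S * order C)" "coprime (order S) (order C)"
  shows "cyc (A \<times>\<times> S \<times>\<times> C) < 2 ^ (num_primes (A \<times>\<times> S \<times>\<times> C) + 2) \<longleftrightarrow> eta S * delta C < 4"
proof -
  let ?a = "num_primes A" and ?s = "num_primes S" and ?c = "num_primes C"
  have "cyc (A \<times>\<times> S \<times>\<times> C) = 2 ^ ?a * (cyc S * card {d. d dvd order C})"
    using assms
    by (simp add: cyc_DirProd_coprime DirProd_group order_DirProd cyc_cyclic card_divisors_squarefree num_primes_def)
  moreover have "num_primes (A \<times>\<times> S \<times>\<times> C) = ?a + (?s + ?c)"
    using assms by (simp add: num_primes_DirProd_coprime DirProd_group order_DirProd)
  ultimately have "cyc (A \<times>\<times> S \<times>\<times> C) < 2 ^ (num_primes (A \<times>\<times> S \<times>\<times> C) + 2) \<longleftrightarrow>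
      cyc S * card {d. d dvd order C} < 4 * 2 ^ (?s + ?c)"
    by (simp add: power_add)
  also have "\<dots> \<longleftrightarrow> real (cyc S * card {d. d dvd order C}) < real (4 * 2 ^ (?s + ?c))"
    by (rule of_nat_less_iff[symmetric])
  also have "\<dots> \<longleftrightarrow> eta S * delta C < 4"
    by (simp add: eta_def delta_def power_add divide_less_eq mult.assoc)
  finally show ?thesis .
qed

section \<open>Complements of central Hall subgroups\<close>

lemma (in group) subgroup_comm_group:
  assumes "subgroup N G" "\<And>n m. n \<in> N \<Longrightarrow> m \<in> N \<Longrightarrow> n \<otimes> m = m \<otimes> n"
  shows "comm_group (G\<lparr>carrier := N\<rparr>)"
  using assms subgroup_imp_group[OF assms(1)]
  by (auto intro: group.group_comm_groupI)

text \<open>The transfer into a central Hall subgroup \<open>N\<close> of index \<open>m\<close> is a homomorphism that restricts to the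
  injective map \<open>n \<mapsto> n ^ m\<close> on \<open>N\<close>, so its kernel is a complement.\<close>

lemma (in group) central_hall_complement:
  assumes fin: "finite (carrier G)" and N: "subgroup N G"
    and central: "\<And>n x. n \<in> N \<Longrightarrow> x \<in> carrier G \<Longrightarrow> n \<otimes> x = x \<otimes> n"
    and coprime: "coprime (card N) (card (rcosets N))"
  obtains K where "subgroup K G" "N \<inter> K = {\<one>}" "\<And>g. g \<in> carrier G \<Longrightarrow> \<exists>n\<in>N. \<exists>k\<in>K. g = n \<otimes> k"
proof -
  interpret N: subgroup N G by fact
  let ?N = "G\<lparr>carrier := N\<rparr>"
  interpret NG: comm_group ?N
    using N central by (intro subgroup_comm_group) auto
  \<comment> \<open>\<open>rep\<close> chooses coset representatives, \<open>r x\<close> is the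
    \<open>N\<close>-part of \<open>x\<close> relative to the representative of its coset, and
    \<open>V\<close> is the transfer: the product in \<open>N\<close> of these parts of
    \<open>rep D \<otimes> g\<close> over all cosets \<open>D\<close>.\<close>
  define rep where "rep D = (SOME x. x \<in> D)" for D :: "'a set"
  define r where "r x = x \<otimes> inv (rep (N #> x))" for x
  define V where "V g = (\<Otimes>\<^bsub>?N\<^esub>D\<in>rcosets N. r (rep D \<otimes> g))" for g
  have rep: "rep (N #> x) \<in> N #> x" "rep (N #> x) \<in> carrier G" if "x \<in> carrier G" for x
  proof -
    show "rep (N #> x) \<in> N #> x"
      unfolding rep_def using rcos_self[OF that N] by (rule someI)
    then show "rep (N #> x) \<in> carrier G"
      using r_coset_subset_G[OF N.subset that] by auto
  qed
  have coset: "N #> (n \<otimes> x) = N #> x" if "n \<in> N" "x \<in> carrier G" for n x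
    using that N by (metis N.mem_carrier coset_join2 coset_mult_assoc N.subset)
  have r: "r x \<in> N" "r x \<otimes> rep (N #> x) = x" if x: "x \<in> carrier G" for x
  proof -
    obtain n where n: "n \<in> N" "rep (N #> x) = n \<otimes> x"
      using rep(1)[OF x] by (auto simp: r_coset_def)
    then show "r x \<in> N"
      using x by (simp add: r_def inv_mult_group flip: m_assoc)
    show "r x \<otimes> rep (N #> x) = x"
      using x rep(2)[OF x] by (simp add: r_def m_assoc)
  qed
  have r_mult: "r (n \<otimes> x) = n \<otimes> r x" if "n \<in> N" "x \<in> carrier G" for n x
    using that rep(2) by (simp add: r_def coset m_assoc)
  have rcos: "rep D \<in> carrier G" "N #> rep D = D" if D: "D \<in> rcosets N" for D
  proof -
    obtain x where x: "x \<in> carrier G" "D = N #> x"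
      using D by (auto simp: RCOSETS_def)
    then show "rep D \<in> carrier G"
      using rep by simp
    show "N #> rep D = D"
      using x rep(1) repr_independence[OF _ x(1) N] by metis
  qed
  have r_rep: "r (rep D) = \<one>" if "D \<in> rcosets N" for D
    using rcos[OF that] by (simp add: r_def)
  have V_closed: "V g \<in> N" if "g \<in> carrier G" for g
    unfolding V_def using NG.finprod_closed[of "\<lambda>D. r (rep D \<otimes> g)" "rcosets N"] that rcos r by auto
  \<comment> \<open>Right multiplication by \<open>g\<close> permutes the cosets, with inverse given
    by \<open>inv g\<close>. This allows the reindexing that makes \<open>V\<close>
    multiplicative.\<close>
  have shift: "(\<lambda>D. D #> g) ` (rcosets N) = rcosets N" "inj_on (\<lambda>D. D #> g) (rcosets N)"
    if g: "g \<in> carrier G" for g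
  proof -
    have mem: "D #> h \<in> rcosets N" if "D \<in> rcosets N" "h \<in> carrier G" for D h
      using that N.subset by (auto simp: RCOSETS_def coset_mult_assoc)
    have inv: "D #> h #> inv h = D" "D #> inv h #> h = D" if "D \<in> rcosets N" "h \<in> carrier G" for D h
      using that N.subset by (auto simp: RCOSETS_def coset_mult_assoc m_assoc)
    show "(\<lambda>D. D #> g) ` (rcosets N) = rcosets N"
    proof (intro equalityI subsetI)
      fix D assume "D \<in> rcosets N"
      then show "D \<in> (\<lambda>D. D #> g) ` (rcosets N)"
        using mem[of D "inv g"] inv(2)[of D g] g by (intro image_eqI[of _ _ "D #> inv g"]) simp_all
    qed (use mem g in blast)
    show "inj_on (\<lambda>D. D #> g) (rcosets N)"
      by (rule inj_on_inverseI[where g = "\<lambda>D. D #> inv g"]) (rule inv(1)[OF _ g])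
  qed
  have V_mult: "V (g \<otimes> h) = V g \<otimes> V h" if g: "g \<in> carrier G" and h: "h \<in> carrier G" for g h
  proof -
    \<comment> \<open>Cocycle identity: \<open>rep D \<otimes> g\<close> is its
      \<open>N\<close>-part times \<open>rep (D #> g)\<close>. After multiplying by
      \<open>h\<close>, the first \<open>N\<close>-part can be pulled out of
      \<open>r\<close>.\<close>
    have split: "r (rep D \<otimes> (g \<otimes> h)) = r (rep D \<otimes> g) \<otimes> r (rep (D #> g) \<otimes> h)"
      if D: "D \<in> rcosets N" for D
    proof -
      have c: "rep D \<otimes> g \<in> carrier G"
        using rcos(1)[OF D] g by simp
      have "N #> (rep D \<otimes> g) = D #> g"
        using rcos[OF D] g N.subset by (metis coset_mult_assoc)
      then have "rep D \<otimes> (g \<otimes> h) = r (rep D \<otimes> g) \<otimes> (rep (D #> g) \<otimes> h)"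
        using r[OF c] rep(2)[OF c] rcos(1)[OF D] g h by (metis N.mem_carrier m_assoc)
      then show ?thesis
        using r(1)[OF c] rep(2)[OF c] \<open>N #> (rep D \<otimes> g) = D #> g\<close> h by (simp add: r_mult)
    qed
    have mem: "r (rep D \<otimes> x) \<in> N" if "D \<in> rcosets N" "x \<in> carrier G" for D x
      using that rcos(1) r(1) by simp
    have shift_mem: "D #> g \<in> rcosets N" if "D \<in> rcosets N" for D
      using that shift(1)[OF g] by blast
    have "V (g \<otimes> h) = (\<Otimes>\<^bsub>?N\<^esub>D\<in>rcosets N. r (rep D \<otimes> g) \<otimes>\<^bsub>?N\<^esub> r (rep (D #> g) \<otimes> h))"
      unfolding V_def using mem g h shift_mem
      by (intro NG.finprod_cong') (auto simp: split)
    also have "\<dots> = V g \<otimes> (\<Otimes>\<^bsub>?N\<^esub>D\<in>rcosets N. r (rep (D #> g) \<otimes> h))"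
      unfolding V_def using mem g h shift_mem by (subst NG.finprod_multf) auto
    also have "(\<Otimes>\<^bsub>?N\<^esub>D\<in>rcosets N. r (rep (D #> g) \<otimes> h)) = V h"
      unfolding V_def using NG.finprod_reindex[of "\<lambda>D. r (rep D \<otimes> h)" "\<lambda>D. D #> g" "rcosets N"]
        shift[OF g] mem h by auto
    finally show ?thesis .
  qed
  \<comment> \<open>Since \<open>n\<close> is central, it can be moved to the left of
    \<open>rep D\<close>, so every factor of the transfer equals \<open>n\<close>.\<close>
  have V_N: "V n = n [^]\<^bsub>?N\<^esub> card (rcosets N)" if n: "n \<in> N" for n
  proof -
    have "V n = (\<Otimes>\<^bsub>?N\<^esub>D\<in>rcosets N. n)"
      unfolding V_def
    proof (rule NG.finprod_cong')
      fix D assume D: "D \<in> rcosets N"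
      then have "r (rep D \<otimes> n) = r (n \<otimes> rep D)"
        using n rcos(1) central[of n "rep D"] by simp
      then show "r (rep D \<otimes> n) = n"
        using D n rcos(1) r_rep by (simp add: r_mult)
    qed (use n in auto)
    then show ?thesis
      using n NG.finprod_const[of n "rcosets N"] by simp
  qed
  interpret V: group_hom G ?N V
    using V_closed V_mult by unfold_locales (auto simp: hom_def)
  have V_inj: "n = \<one>" if n: "n \<in> N" "V n = \<one>" for n
  proof -
    have nG: "n \<in> carrier G"
      using n by simp
    have "NG.ord n dvd card N"
      using NG.ord_dvd_group_order[of n] n by (simp add: order_def)
    moreover have "NG.ord n dvd card (rcosets N)"
      using n V_N NG.pow_eq_id[of n "card (rcosets N)"] by simp
    ultimately have "NG.ord n = 1"
      using coprime by (metis coprime_common_divisor_nat)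
    then show ?thesis
      using NG.ord_eq_1[of n] n by simp
  qed
  have V_one: "V \<one> = \<one>"
    using V.hom_one by simp
  \<comment> \<open>An injective map of the finite set \<open>N\<close> to itself is onto. Hence
    each \<open>g\<close> has some \<open>n\<close> in \<open>N\<close> with the same transfer, and
    \<open>inv n \<otimes> g\<close> lies in the kernel.\<close>
  have "V ` N = N"
  proof (rule card_subset_eq)
    show "finite N"
      using fin N.subset by (rule rev_finite_subset)
    show "V ` N \<subseteq> N"
      using V_closed by auto
    have "inj_on V N"
    proof (rule inj_onI)
      fix a b assume ab: "a \<in> N" "b \<in> N" "V a = V b"
      then have "V (a \<otimes> inv b) = V (b \<otimes> inv b)"
        by (metis N.mem_carrier V_mult inv_closed)
      then have "V (a \<otimes> inv b) = \<one>"
        using ab V_one by (metis N.mem_carrier r_inv)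
      then have "a \<otimes> inv b = \<one>"
        by (rule V_inj[OF N.m_closed[OF ab(1) N.m_inv_closed[OF ab(2)]]])
      then show "a = b"
        using ab by (metis N.mem_carrier inv_closed inv_equality inv_inv)
    qed
    then show "card (V ` N) = card N"
      by (rule card_image)
  qed
  show thesis
  proof (rule that)
    show "subgroup (kernel G ?N V) G"
      by (rule V.subgroup_kernel)
    show "N \<inter> kernel G ?N V = {\<one>}"
      using V_inj V_one by (auto simp: kernel_def)
    fix g assume g: "g \<in> carrier G"
    obtain n where n: "n \<in> N" "V n = V g"
      using V_closed[OF g] \<open>V ` N = N\<close> by (metis imageE)
    then have "V (inv n \<otimes> g) = V (inv n \<otimes> n)"
      using g by (metis N.mem_carrier V_mult inv_closed)
    then have "V (inv n \<otimes> g) = \<one>"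
      using n V_one by (metis N.mem_carrier l_inv)
    then have "inv n \<otimes> g \<in> kernel G ?N V"
      using n g by (simp add: kernel_def)
    moreover have "g = n \<otimes> (inv n \<otimes> g)"
      using n g by (simp flip: m_assoc)
    ultimately show "\<exists>n\<in>N. \<exists>k\<in>kernel G ?N V. g = n \<otimes> k"
      using n by blast
  qed
qed

section \<open>Splitting off a maximal central cyclic Hall subgroup\<close>

lemma (in group) ord_mult_coprime:
  assumes xy: "x \<in> carrier G" "y \<in> carrier G" "x \<otimes> y = y \<otimes> x" and "coprime (ord x) (ord y)"
  shows "ord (x \<otimes> y) = ord x * ord y"
proof (rule dvd_antisym)
  show "ord (x \<otimes> y) dvd ord x * ord y"
    using assms by (intro ord_mul_divides) auto
  have "ord u dvd ord (u \<otimes> v)"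
    if uv: "u \<in> carrier G" "v \<in> carrier G" "u \<otimes> v = v \<otimes> u" and "coprime (ord u) (ord v)" for u v
  proof -
    \<comment> \<open>This exponent kills \<open>u \<otimes> v\<close> and \<open>v\<close>, hence
      \<open>u\<close>. So \<open>ord u\<close> divides \<open>?k\<close>, and being coprime to
      \<open>ord v\<close> it divides \<open>ord (u \<otimes> v)\<close>.\<close>
    let ?k = "ord (u \<otimes> v) * ord v"
    have "(u \<otimes> v) [^] ?k = \<one>" "v [^] ?k = \<one>"
      using uv by (simp_all add: pow_eq_id)
    then have "u [^] ?k = \<one>"
      using uv pow_mult_distrib[OF uv(3,1,2), of ?k] by simp
    then show ?thesis
      using uv that(4) by (simp add: pow_eq_id coprime_dvd_mult_left_iff)
  qed
  from this[of x y] this[of y x] show "ord x * ord y dvd ord (x \<otimes> y)"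
    using assms by (intro divides_mult) (auto simp: ac_simps)
qed

lemma (in group) order_internal_product:
  assumes "subgroup N G" "subgroup K G" "N \<inter> K = {\<one>}"
    and "\<And>g. g \<in> carrier G \<Longrightarrow> \<exists>n\<in>N. \<exists>k\<in>K. g = n \<otimes> k"
  shows "order G = card N * card K"
proof -
  interpret group_disjoint_sum G N K
    using assms by (simp add: group_disjoint_sum_def)
  have "inj_on (\<lambda>(n, k). n \<otimes> k) (N \<times> K)"
    using cancel assms(3) by (auto intro!: inj_onI)
  moreover have "(\<lambda>(n, k). n \<otimes> k) ` (N \<times> K) = carrier G"
    using assms(4) by (force simp: image_iff)
  ultimately show ?thesis
    by (metis card_cartesian_product card_image order_def)
qed

lemma (in group) cyclic_subgroup_restrict:
  "cyclic_group (G\<lparr>carrier := generate G {x}\<rparr>)" if "x \<in> carrier G"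
  using cyclic_group_generated[of x] that by (simp add: subgroup_generated_def)

lemma max_central_cyclic_complement:
  fixes G :: "'a monoid" (structure)
  assumes "group G" and fin: "finite (carrier G)"
  obtains z K where "z \<in> group_center G" "subgroup K G" "generate G {z} \<inter> K = {\<one>}"
    "coprime (group.ord G z) (card K)" "order G = group.ord G z * card K"
    "\<not> (\<exists>p P. sylow_subgroup p P (G\<lparr>carrier := K\<rparr>) \<and> cyclic_group (G\<lparr>carrier := P\<rparr>) \<and>
      P \<subseteq> group_center (G\<lparr>carrier := K\<rparr>))"
proof -
  interpret group G by fact
  have pos: "order G > 0"
    using fin by (simp add: order_gt_0_iff_finite)
  \<comment> \<open>The coprimality condition says that the subgroup generated by \<open>z\<close>
    is a Hall subgroup. The identity satisfies it, so a maximum exists.\<close>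
  define Z where "Z = {z \<in> group_center G. coprime (ord z) (order G div ord z)}"
  have "finite Z" "\<one> \<in> Z"
    using fin by (auto simp: Z_def group_center_def)
  then have "Max (ord ` Z) \<in> ord ` Z"
    by (intro Max_in) auto
  then obtain z where z: "z \<in> Z" "ord z = Max (ord ` Z)"
    by auto
  have max: "ord w \<le> ord z" if "w \<in> Z" for w
    using that \<open>finite Z\<close> z(2) by simp
  have zG: "z \<in> carrier G" and zc: "\<And>x. x \<in> carrier G \<Longrightarrow> z \<otimes> x = x \<otimes> z"
    and zcop: "coprime (ord z) (order G div ord z)"
    using z by (auto simp: Z_def group_center_def)
  let ?N = "generate G {z}"
  have N: "subgroup ?N G"
    using zG by (simp add: generate_is_subgroup)
  have cardN: "card ?N = ord z"
    using zG by (simp add: generate_pow_card)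
  have Nc: "n \<otimes> x = x \<otimes> n" if n: "n \<in> ?N" and x: "x \<in> carrier G" for n x
  proof -
    obtain k :: nat where "n = z [^] k"
      using n generate_pow_on_finite_carrier[OF fin zG] by blast
    then show ?thesis
      using zG x zc[OF x] by (metis group_commutes_pow)
  qed
  have "ord z > 0"
    using fin zG ord_ge_1 by force
  then have "card (rcosets ?N) = order G div ord z"
    using lagrange[OF N] cardN by (metis nonzero_mult_div_cancel_right not_gr_zero)
  then obtain K where K: "subgroup K G" "?N \<inter> K = {\<one>}"
      and prod: "\<And>g. g \<in> carrier G \<Longrightarrow> \<exists>n\<in>?N. \<exists>k\<in>K. g = n \<otimes> k"
    using central_hall_complement[OF fin N Nc] zcop cardN by metis
  have ordG: "order G = ord z * card K"
    using order_internal_product[OF N K prod] cardN by simp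
  then have cop: "coprime (ord z) (card K)"
    using zcop \<open>ord z > 0\<close> by simp
  have "\<not> (sylow_subgroup p P (G\<lparr>carrier := K\<rparr>) \<and> cyclic_group (G\<lparr>carrier := P\<rparr>) \<and>
      P \<subseteq> group_center (G\<lparr>carrier := K\<rparr>))" for p P
  proof (intro notI, elim conjE)
    assume syl: "sylow_subgroup p P (G\<lparr>carrier := K\<rparr>)" and cyc: "cyclic_group (G\<lparr>carrier := P\<rparr>)"
      and cent: "P \<subseteq> group_center (G\<lparr>carrier := K\<rparr>)"
    let ?e = "multiplicity p (card K)"
    have p: "prime p" "p dvd card K" "card P = p ^ ?e" "subgroup P (G\<lparr>carrier := K\<rparr>)"
      using syl by (auto simp: sylow_subgroup_def order_def)
    have "subgroup P G"
      using incl_subgroup[OF K(1) p(4)] .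
    then obtain x where x: "x \<in> carrier G" "P = generate G {x}"
      using cyc cyclic_subgroups_eq by blast
    have ordx: "ord x = p ^ ?e"
      using x p(3) generate_pow_card by simp
    have "x \<in> P"
      using x(2) by (simp add: generate.incl)
    then have xc: "x \<otimes> k = k \<otimes> x" if "k \<in> K" for k
      using cent that by (auto simp: group_center_def)
    \<comment> \<open>\<open>x\<close> commutes with \<open>K\<close> because \<open>P\<close> is
      central there, and with \<open>?N\<close> because \<open>?N\<close> is central in
      \<open>G\<close>; together these generate \<open>G\<close>.\<close>
    have xcent: "x \<otimes> g = g \<otimes> x" if g: "g \<in> carrier G" for g
    proof -
      obtain n k where nk: "n \<in> ?N" "k \<in> K" "g = n \<otimes> k"
        using prod[OF g] by blast
      then have "n \<in> carrier G" "k \<in> carrier G"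
        using N K(1) by (auto dest: subgroup.mem_carrier)
      then show ?thesis
        using nk x(1) xc[OF nk(2)] Nc[OF nk(1) x(1)] by (metis m_assoc)
    qed
    have "card K > 0"
      using pos ordG by simp
    \<comment> \<open>\<open>m\<close> is the part of \<open>card K\<close> prime to
      \<open>p\<close>. It turns out to be the index of the subgroup generated by
      \<open>z \<otimes> x\<close>, so \<open>z \<otimes> x\<close> again belongs to
      \<open>Z\<close>, with an order larger by the factor \<open>p ^ ?e\<close>.\<close>
    then obtain m where m: "card K = p ^ ?e * m" "\<not> p dvd m"
      using multiplicity_decompose'[of "card K" p] p(1) by (metis not_prime_unit not_gr_zero)
    have e: "?e > 0"
      using p \<open>card K > 0\<close> by (simp add: prime_multiplicity_gt_zero_iff)
    have copx: "coprime (ord z) (p ^ ?e)" "coprime (ord z) m"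
      using cop m(1) by (metis coprime_mult_right_iff)+
    have ordw: "ord (z \<otimes> x) = ord z * p ^ ?e"
      using ord_mult_coprime[OF zG x(1) zc[OF x(1)]] copx(1) ordx by simp
    have "order G = ord (z \<otimes> x) * m"
      using ordG m(1) ordw by (simp add: mult.assoc)
    moreover have "ord (z \<otimes> x) > 0"
      using fin zG x(1) ord_ge_1[of "z \<otimes> x"] by simp
    ultimately have "order G div ord (z \<otimes> x) = m"
      by simp
    moreover have "coprime (p ^ ?e) m"
      using p(1) m(2) by (simp add: prime_imp_coprime)
    ultimately have "coprime (ord (z \<otimes> x)) (order G div ord (z \<otimes> x))"
      using copx(2) ordw by simp
    moreover have "z \<otimes> x \<otimes> g = g \<otimes> (z \<otimes> x)" if "g \<in> carrier G" for g
      using zG x(1) zc[OF that] xcent[OF that] that by (metis m_assoc)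
    then have "z \<otimes> x \<in> group_center G"
      using zG x(1) by (simp add: group_center_def)
    ultimately have "ord (z \<otimes> x) \<le> ord z"
      by (intro max) (simp add: Z_def)
    moreover have "1 < p ^ ?e"
      using e prime_gt_1_nat[OF p(1)] by (intro one_less_power) auto
    ultimately show False
      using ordw \<open>ord z > 0\<close> by simp
  qed
  then show thesis
    using that[of z K] z(1) K cop ordG by (simp add: Z_def)
qed

section \<open>The decomposition into three coprime factors\<close>

lemma (in group) coprime_pow_generate_disjoint:
  assumes fin: "finite (carrier G)" and z: "z \<in> carrier G" "ord z = a * c" "coprime a c"
  shows "generate G {z [^] c} \<inter> generate G {z [^] a} = {\<one>}"
proof -
  have "u = \<one>" if u: "u \<in> generate G {z [^] c}" "u \<in> generate G {z [^] a}" for u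
  proof -
    obtain i j :: nat where ij: "u = (z [^] c) [^] i" "u = (z [^] a) [^] j"
      using u unfolding generate_pow_on_finite_carrier[OF fin nat_pow_closed[OF z(1)]] by blast
    \<comment> \<open>Powers of \<open>z [^] c\<close> are killed by \<open>a\<close> and powers of
      \<open>z [^] a\<close> by \<open>c\<close>, so the order of a common element divides
      both.\<close>
    have "(z [^] c) [^] (i * a) = \<one>" "(z [^] a) [^] (j * c) = \<one>"
      using z by (simp_all add: nat_pow_pow pow_eq_id)
    then have "u [^] a = \<one>" "u [^] c = \<one>"
      using z(1) ij by (metis nat_pow_closed nat_pow_pow)+
    moreover have uG: "u \<in> carrier G"
      using ij(1) z(1) by simp
    ultimately have "ord u dvd a" "ord u dvd c"
      by (simp_all add: pow_eq_id)
    then have "ord u = 1"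
      using z(3) by (metis coprime_common_divisor_nat)
    then show ?thesis
      using uG ord_eq_1 by blast
  qed
  then show ?thesis
    using generate.one by blast
qed

text \<open>Every finite group splits in this way; the bound on \<open>cyc\<close> enters only
  afterwards, through \<open>cyc_threshold_iff\<close>.\<close>

lemma threshold_decomposition:
  fixes G :: "'g monoid" (structure)
  assumes "group G" and fin: "finite (carrier G)"
  obtains A S C :: "'g monoid" where
    "group A" "finite (carrier A)" "cyclic_group A" "squarefree (order A)"
    "group S" "finite (carrier S)"
    "\<not> (\<exists>p P. sylow_subgroup p P S \<and> cyclic_group (S\<lparr>carrier := P\<rparr>) \<and> P \<subseteq> group_center S)"
    "group C" "finite (carrier C)" "cyclic_group C"
    "\<forall>p \<in> prime_factors (order C). 2 \<le> multiplicity p (order C)"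
    "coprime (order A) (order S * order C)" "coprime (order S) (order C)"
    "A \<times>\<times> S \<times>\<times> C \<cong> G"
proof -
  interpret group G by fact
  obtain z K where z: "z \<in> group_center G" and K: "subgroup K G" "generate G {z} \<inter> K = {\<one>}"
    and cop: "coprime (ord z) (card K)" and ordG: "order G = ord z * card K"
    and syl: "\<not> (\<exists>p P. sylow_subgroup p P (G\<lparr>carrier := K\<rparr>) \<and> cyclic_group (G\<lparr>carrier := P\<rparr>) \<and>
      P \<subseteq> group_center (G\<lparr>carrier := K\<rparr>))"
    using max_central_cyclic_complement[OF assms] by metis
  have zG: "z \<in> carrier G" and zc: "\<And>x. x \<in> carrier G \<Longrightarrow> z \<otimes> x = x \<otimes> z"
    using z by (auto simp: group_center_def)
  have "ord z > 0"
    using fin zG ord_ge_1 by force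
  then obtain a c where ac: "ord z = a * c" "coprime a c" "squarefree a"
    "\<And>p. p \<in> prime_factors c \<Longrightarrow> 2 \<le> multiplicity p c"
    using squarefree_squareful_decomposition by metis
  have pos: "a > 0" "c > 0"
    using ac(1) \<open>ord z > 0\<close> by auto
  \<comment> \<open>The exponents are crossed: since \<open>ord z = a * c\<close>, the element
    \<open>z [^] c\<close> has order \<open>a\<close> and \<open>z [^] a\<close> has order
    \<open>c\<close>.\<close>
  define HA where "HA = generate G {z [^] c}"
  define HC where "HC = generate G {z [^] a}"
  have sub: "subgroup HA G" "subgroup HC G" "subgroup (generate G {z}) G"
    using zG by (simp_all add: HA_def HC_def generate_is_subgroup)
  have mem: "z [^] k \<in> generate G {z}" for k :: nat
    unfolding generate_pow_on_finite_carrier[OF fin zG] by blast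
  have subz: "HA \<subseteq> generate G {z}" "HC \<subseteq> generate G {z}"
    unfolding HA_def HC_def using mem by (intro generate_subgroup_incl[OF _ sub(3)]; simp)+
  have cardAC: "card HA = a" "card HC = c"
    using zG pos ac(1) by (simp_all add: HA_def HC_def ord_pow flip: generate_pow_card)
  have central: "n \<otimes> x = x \<otimes> n" if n: "n \<in> generate G {z}" and x: "x \<in> carrier G" for n x
  proof -
    obtain k :: nat where "n = z [^] k"
      using n generate_pow_on_finite_carrier[OF fin zG] by blast
    then show ?thesis
      using zG x zc[OF x] by (metis group_commutes_pow)
  qed
  have carr: "x \<in> carrier G" if "x \<in> HA \<or> x \<in> K \<or> x \<in> HC" for x
    using that sub K(1) by (auto dest: subgroup.mem_carrier)
  define f where "f = (\<lambda>(x, s, y). x \<otimes> (s \<otimes> y))"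
  let ?A = "G\<lparr>carrier := HA\<rparr>" and ?S = "G\<lparr>carrier := K\<rparr>" and ?C = "G\<lparr>carrier := HC\<rparr>"
  \<comment> \<open>Bringing the two central factors together lets injectivity be checked in two
    stages: first across the generated subgroup and \<open>K\<close>, then across \<open>HA\<close>
    and \<open>HC\<close>.\<close>
  have f_eq: "f (x, s, y) = (x \<otimes> y) \<otimes> s" if "x \<in> HA" "s \<in> K" "y \<in> HC" for x s y
    using that central[of y s] subz(2) carr by (simp add: f_def m_assoc subset_iff)
  have "f \<in> hom (?A \<times>\<times> ?S \<times>\<times> ?C) G"
  proof (rule homI)
    fix u v assume "u \<in> carrier (?A \<times>\<times> ?S \<times>\<times> ?C)" "v \<in> carrier (?A \<times>\<times> ?S \<times>\<times> ?C)"
    then obtain x s y x' s' y' where uv: "u = (x, s, y)" "v = (x', s', y')"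
      and m: "x \<in> HA" "s \<in> K" "y \<in> HC" "x' \<in> HA" "s' \<in> K" "y' \<in> HC"
      by auto
    then have c: "x \<in> carrier G" "s \<in> carrier G" "y \<in> carrier G" "x' \<in> carrier G" "s' \<in> carrier G"
      "y' \<in> carrier G"
      using carr by auto
    have "(x \<otimes> x') \<otimes> ((s \<otimes> s') \<otimes> (y \<otimes> y')) = (x \<otimes> (s \<otimes> y)) \<otimes> (x' \<otimes> (s' \<otimes> y'))"
    proof -
      have "(s \<otimes> y) \<otimes> (s' \<otimes> y') = s \<otimes> ((y \<otimes> s') \<otimes> y')"
        using c by (simp add: m_assoc)
      also have "y \<otimes> s' = s' \<otimes> y"
        using central[of y s'] m subz c by blast
      finally have sy: "(s \<otimes> y) \<otimes> (s' \<otimes> y') = (s \<otimes> s') \<otimes> (y \<otimes> y')"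
        using c by (simp add: m_assoc)
      have "(x \<otimes> (s \<otimes> y)) \<otimes> (x' \<otimes> (s' \<otimes> y')) = x \<otimes> (((s \<otimes> y) \<otimes> x') \<otimes> (s' \<otimes> y'))"
        using c by (simp add: m_assoc)
      also have "(s \<otimes> y) \<otimes> x' = x' \<otimes> (s \<otimes> y)"
        using central[of x' "s \<otimes> y"] m subz c by (metis m_closed subsetD)
      also have "x \<otimes> ((x' \<otimes> (s \<otimes> y)) \<otimes> (s' \<otimes> y')) = (x \<otimes> x') \<otimes> ((s \<otimes> y) \<otimes> (s' \<otimes> y'))"
        using c by (simp add: m_assoc)
      finally show ?thesis
        by (simp only: sy)
    qed
    then show "f (u \<otimes>\<^bsub>?A \<times>\<times> ?S \<times>\<times> ?C\<^esub> v) = f u \<otimes> f v"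
      by (simp add: uv f_def)
  qed (auto simp: f_def carr)
  moreover have "inj_on f (carrier (?A \<times>\<times> ?S \<times>\<times> ?C))"
  proof -
    interpret NK: group_disjoint_sum G "generate G {z}" K
      using sub K(1) by (simp add: group_disjoint_sum_def)
    interpret AC: group_disjoint_sum G HA HC
      using sub by (simp add: group_disjoint_sum_def)
    have AC: "HA \<inter> HC = {\<one>}"
      unfolding HA_def HC_def using fin zG ac(1,2) by (rule coprime_pow_generate_disjoint)
    show ?thesis
    proof (rule inj_onI, clarsimp)
      fix x s y x' s' y'
      assume m: "x \<in> HA" "s \<in> K" "y \<in> HC" "x' \<in> HA" "s' \<in> K" "y' \<in> HC"
        and eq: "f (x, s, y) = f (x', s', y')"
      have "x \<otimes> y \<in> generate G {z}" "x' \<otimes> y' \<in> generate G {z}"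
        using m subz sub(3) by (auto intro: subgroup.m_closed)
      moreover have "(x \<otimes> y) \<otimes> s = (x' \<otimes> y') \<otimes> s'"
        using eq m f_eq by simp
      ultimately have "x \<otimes> y = x' \<otimes> y' \<and> s = s'"
        using NK.cancel K(2) m by blast
      then show "x = x' \<and> s = s' \<and> y = y'"
        using AC.cancel AC m by blast
    qed
  qed
  ultimately have "f \<in> iso (?A \<times>\<times> ?S \<times>\<times> ?C) G"
    using fin ordG ac(1) cardAC
    by (intro iso_if_card_eq) (simp_all add: card_cartesian_product order_def)
  then have iso: "?A \<times>\<times> ?S \<times>\<times> ?C \<cong> G"
    by (rule is_isoI)
  have fin': "finite HA" "finite K" "finite HC"
    using sub K(1) fin by (auto intro: finite_subset[OF subgroup.subset])
  show thesis
  proof (rule that[OF _ _ _ _ _ _ _ _ _ _ _ _ _ iso])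
    show "cyclic_group ?A" "cyclic_group ?C"
      using zG by (simp_all add: HA_def HC_def cyclic_subgroup_restrict)
  qed (use sub K(1) fin' cardAC ac cop syl in
      \<open>simp_all add: subgroup_imp_group order_def coprime_commute\<close>)
qed

section \<open>From the decomposition to threshold triples\<close>

lemma (in group) cyclic_group_if_prime_order:
  assumes "prime (order G)"
  shows "cyclic_group G"
proof -
  have fin: "finite (carrier G)"
    using assms by (simp add: prime_gt_0_nat flip: order_gt_0_iff_finite)
  have "carrier G \<noteq> {\<one>}"
    using assms order_one_triv_iff not_prime_1 by metis
  then obtain x where x: "x \<in> carrier G" "x \<noteq> \<one>"
    by blast
  then have "ord x = order G"
    using assms ord_dvd_group_order[of x] ord_eq_1[of x] by (metis prime_nat_iff)
  then have "generate G {x} = carrier G"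
    using x fin generate_incl[of "{x}"] generate_pow_card[of x]
    by (intro card_subset_eq) (simp_all add: order_def)
  then show ?thesis
    using cyclic_subgroup_restrict[OF x(1)] by simp
qed

lemma threshold_tripleI:
  fixes A :: "'a monoid" and S :: "'b monoid" and C :: "'c monoid"
  assumes A: "group A" "finite (carrier A)" "cyclic_group A" "squarefree (order A)"
    and S: "group S" "finite (carrier S)"
      "\<not> (\<exists>p P. sylow_subgroup p P S \<and> cyclic_group (S\<lparr>carrier := P\<rparr>) \<and> P \<subseteq> group_center S)"
    and C: "group C" "finite (carrier C)" "cyclic_group C"
      "\<forall>p \<in> prime_factors (order C). 2 \<le> multiplicity p (order C)"
    and coprime: "coprime (order A) (order S * order C)" "coprime (order S) (order C)"
    and less: "eta S * delta C < 4"
  shows "threshold_triple A S C"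
proof -
  \<comment> \<open>Sylow subgroups of prime order are cyclic, so having no central cyclic Sylow
    subgroup already makes \<open>S\<close> squarefree-reduced.\<close>
  have prime_cyclic: "cyclic_group (S\<lparr>carrier := P\<rparr>)" if P: "subgroup P S" "prime (card P)" for P
    using group.cyclic_group_if_prime_order[OF group.subgroup_imp_group[OF S(1) P(1)]] P(2)
    by (simp add: order_def)
  have "squarefree_reduced S"
    using S(3) prime_cyclic by (auto simp: squarefree_reduced_def sylow_subgroup_def)
  moreover have "eta S < 4"
  proof -
    have "eta S \<ge> 0"
      by (simp add: eta_def)
    then have "eta S * 1 \<le> eta S * delta C"
      using delta_ge_1[OF C(1,2)] by (intro mult_left_mono)
    then show ?thesis
      using less by simp
  qed
  ultimately have "trivial_group S \<or> fundamental_block S"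
    using S by (simp add: fundamental_block_def)
  moreover have "primary_decomposition C (sorted_list_of_set (prime_factors (order C)))
      (map (\<lambda>p. multiplicity p (order C)) (sorted_list_of_set (prime_factors (order C))))"
    using C(1-3) by (intro primary_decompositionI) simp_all
  moreover have "\<forall>ls as. primary_decomposition C ls as \<longrightarrow> (\<forall>a \<in> set as. 2 \<le> a)"
  proof (intro allI impI ballI)
    fix ls as a assume pd: "primary_decomposition C ls as" and a: "a \<in> set as"
    then obtain p where "p \<in> prime_factors (order C)" "a = multiplicity p (order C)"
      using primary_decompositionD(2,3)[OF pd] by auto
    then show "2 \<le> a"
      using C(4) by simp
  qed
  ultimately show ?thesis
    using assms unfolding threshold_triple_def by blast
qed

section \<open>The threshold\<close>

lemma exists_threshold_triple:
  fixes G :: "'g monoid"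
  assumes "group G" "finite (carrier G)" "cyc G < 2 ^ (num_primes G + 2)"
  obtains A S C :: "'g monoid" where "threshold_triple A S C" "G \<cong> A \<times>\<times> S \<times>\<times> C"
proof -
  obtain A S C :: "'g monoid" where A: "group A" "finite (carrier A)" "cyclic_group A" "squarefree (order A)"
    and S: "group S" "finite (carrier S)"
      "\<not> (\<exists>p P. sylow_subgroup p P S \<and> cyclic_group (S\<lparr>carrier := P\<rparr>) \<and> P \<subseteq> group_center S)"
    and C: "group C" "finite (carrier C)" "cyclic_group C"
      "\<forall>p \<in> prime_factors (order C). 2 \<le> multiplicity p (order C)"
    and coprime: "coprime (order A) (order S * order C)" "coprime (order S) (order C)"
    and iso: "A \<times>\<times> S \<times>\<times> C \<cong> G"
    using threshold_decomposition[OF assms(1,2)] .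
  have P: "group (A \<times>\<times> S \<times>\<times> C)"
    using A S C by (simp add: DirProd_group)
  have "cyc (A \<times>\<times> S \<times>\<times> C) = cyc G"
    using P assms(1) iso by (rule cyc_iso)
  \<comment> \<open>\<open>num_primes\<close> depends on the order only, so the threshold condition
    transfers along the isomorphism.\<close>
  moreover have "order (A \<times>\<times> S \<times>\<times> C) = order G"
    using iso_same_card[OF iso] by (simp add: order_def)
  ultimately have "eta S * delta C < 4"
    using assms(3) cyc_threshold_iff[OF A S(1,2) C(1-3) coprime] by (simp add: num_primes_def)
  then have "threshold_triple A S C"
    using A S C coprime by (intro threshold_tripleI)
  moreover have "G \<cong> A \<times>\<times> S \<times>\<times> C"
    using group.iso_sym[OF P iso] .
  ultimately show thesis
    by (rule that)
qed

lemma delta_less_4_iff: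
  assumes "primary_decomposition C ls as" "order C > 0"
  shows "delta C < 4 \<longleftrightarrow> prod_list (map Suc as) < 4 * 2 ^ length as"
proof -
  have "delta C < 4 \<longleftrightarrow> real (prod_list (map Suc as)) < real (4 * 2 ^ length as)"
    by (simp add: delta_primary_decomposition[OF assms] divide_less_eq)
  then show ?thesis
    by (simp only: of_nat_less_iff)
qed

lemma threshold_triple_patterns:
  assumes "threshold_triple A S C" "trivial_group S" "primary_decomposition C ls as" "sorted_wrt (\<ge>) as"
  shows "as \<in> threshold_patterns"
proof -
  have C: "group C" "finite (carrier C)" and less: "eta S * delta C < 4" and ge: "\<forall>a \<in> set as. 2 \<le> a"
    using assms by (auto simp: threshold_triple_def)
  have "order C > 0"
    using C by (simp add: group.is_monoid monoid.order_gt_0_iff_finite)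
  then show ?thesis
    using less ge delta_less_4_iff[OF assms(3)] assms(2,4) by (simp add: eta_trivial threshold_patterns_iff)
qed

text \<open>The witness takes \<open>A\<close> and \<open>S\<close> trivial and for \<open>C\<close>
  the integers modulo the product of the prescribed prime powers.\<close>

lemma exists_threshold_triple_of_pattern:
  assumes "as \<in> threshold_patterns" "length ls = length as" "distinct ls" "\<forall>l \<in> set ls. prime l"
  obtains A S C :: "int monoid"
  where "threshold_triple A S C" "trivial_group S" "primary_decomposition C ls as"
proof -
  define n where "n = (\<Prod>i<length as. ls ! i ^ as ! i)"
  let ?I = "integer_mod_group 1" and ?C = "integer_mod_group n"
  have "sorted_wrt (\<ge>) as"
    using assms(1) by (auto simp: threshold_patterns_def)
  then have as: "\<forall>a \<in> set as. 2 \<le> a" "prod_list (map Suc as) < 4 * 2 ^ length as"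
    using assms(1) threshold_patterns_iff by auto
  then have "\<forall>a \<in> set as. 1 \<le> a"
    by auto
  note pp = prod_prime_power_list[OF assms(2-4) this, folded n_def]
  have "n > 0"
    using assms(2,4) by (auto simp: n_def prime_gt_0_nat intro!: prod_pos)
  then have C: "group ?C" "finite (carrier ?C)" "cyclic_group ?C" "order ?C = n"
    by (simp_all add: finite_integer_mod_group cyclic_integer_mod_group order_integer_mod_group)
  have triv: "trivial_group ?I"
    by (simp add: trivial_integer_mod_group)
  have I: "group ?I" "finite (carrier ?I)" "cyclic_group ?I" "order ?I = 1"
    by (simp_all add: finite_integer_mod_group cyclic_integer_mod_group order_integer_mod_group)
  have "primary_decomposition ?C ls (map (\<lambda>p. multiplicity p (order ?C)) ls)"
    using C pp(1) assms(3) by (intro primary_decompositionI) simp_all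
  then have pd: "primary_decomposition ?C ls as"
    by (simp only: C(4) pp(2)[symmetric])
  have "threshold_triple ?I ?I ?C"
  proof (rule threshold_tripleI)
    show "\<not> (\<exists>p P. sylow_subgroup p P ?I \<and> cyclic_group (?I\<lparr>carrier := P\<rparr>) \<and> P \<subseteq> group_center ?I)"
      using I(4) by (auto simp: sylow_subgroup_def)
    show "\<forall>p \<in> prime_factors (order ?C). 2 \<le> multiplicity p (order ?C)"
    proof
      fix p assume p: "p \<in> prime_factors (order ?C)"
      have "multiplicity p n \<in> set as"
        using p pp C(4) by (metis image_eqI set_map)
      then show "2 \<le> multiplicity p (order ?C)"
        using as(1) C(4) by simp
    qed
    show "eta ?I * delta ?C < 4"
      using triv as(2) delta_less_4_iff[OF pd] C(4) \<open>n > 0\<close> by (simp add: eta_trivial)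
  qed (use I C in simp_all)
  then show thesis
    using that triv pd by blast
qed

text \<open>In the first clause the type of \<open>G\<close> suffices for the factors, which are
  built on subgroups of \<open>G\<close>. The last clause fixes the integers as carrier type because
  an arbitrary type might be too small for a group of the prescribed order.\<close>

theorem corollary9p4:
  shows
    "(\<forall>G :: 'g monoid. group G \<and> finite (carrier G) \<and> cyc G < 2 ^ (num_primes G + 2) \<longrightarrow>
        (\<exists>(A :: 'g monoid) (S :: 'g monoid) (C :: 'g monoid).
           threshold_triple A S C \<and> G \<cong> A \<times>\<times> S \<times>\<times> C)) \<and>
     (\<forall>(A :: 'a monoid) (S :: 'b monoid) (C :: 'c monoid).
        threshold_triple A S C \<longrightarrow>
          cyc (A \<times>\<times> S \<times>\<times> C) < 2 ^ (num_primes (A \<times>\<times> S \<times>\<times> C) + 2)) \<and>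
     (\<forall>(A :: 'a monoid) (S :: 'b monoid) (C :: 'c monoid) ls as.
        threshold_triple A S C \<and> trivial_group S \<and>
        primary_decomposition C ls as \<and> sorted_wrt (\<ge>) as \<longrightarrow>
          as \<in> threshold_patterns) \<and>
     (\<forall>as \<in> threshold_patterns. \<forall>ls.
        length ls = length as \<and> distinct ls \<and> (\<forall>l \<in> set ls. Factorial_Ring.prime l) \<longrightarrow>
          (\<exists>(A :: int monoid) (S :: int monoid) (C :: int monoid).
             threshold_triple A S C \<and> trivial_group S \<and> primary_decomposition C ls as))"
proof (intro conjI allI impI ballI)
  fix G :: "'g monoid"
  assume "group G \<and> finite (carrier G) \<and> cyc G < 2 ^ (num_primes G + 2)"
  then show "\<exists>(A :: 'g monoid) (S :: 'g monoid) (C :: 'g monoid).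
      threshold_triple A S C \<and> G \<cong> A \<times>\<times> S \<times>\<times> C"
    using exists_threshold_triple by metis
next
  fix A :: "'a monoid" and S :: "'b monoid" and C :: "'c monoid"
  assume "threshold_triple A S C"
  then show "cyc (A \<times>\<times> S \<times>\<times> C) < 2 ^ (num_primes (A \<times>\<times> S \<times>\<times> C) + 2)"
    by (subst cyc_threshold_iff) (auto simp: threshold_triple_def)
next
  fix A :: "'a monoid" and S :: "'b monoid" and C :: "'c monoid" and ls as
  assume "threshold_triple A S C \<and> trivial_group S \<and> primary_decomposition C ls as \<and> sorted_wrt (\<ge>) as"
  then show "as \<in> threshold_patterns"
    using threshold_triple_patterns by blast
next
  fix as ls :: "nat list"
  assume "as \<in> threshold_patterns"
    and "length ls = length as \<and> distinct ls \<and> (\<forall>l \<in> set ls. Factorial_Ring.prime l)"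
  then show "\<exists>(A :: int monoid) (S :: int monoid) (C :: int monoid).
      threshold_triple A S C \<and> trivial_group S \<and> primary_decomposition C ls as"
    using exists_threshold_triple_of_pattern by metis
qed

end
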